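(* Let $X$ be a Banach space of analytic functions on $\mathbb{D}$ on which point evaluation of the derivative is a bounded linear functional (that is, for $z\in\mathbb{D}$ the functional $f\mapsto f'(z)$ is bounded on $X$). Then $S[X]\subseteq H^\infty$.
   Context: $\mathbb{D}=\{z\in\mathbb{C}:|z|<1\}$ and $H(\mathbb{D})$ is the set of analytic functions on $\mathbb{D}$. For $g\in H(\mathbb{D})$, the operator $S_g$ is defined by $S_gf(z)=\int_0^z f'(t)g(t)\,dt$ for $z\in\mathbb{D}$, $f\in H(\mathbb{D})$. For a Banach space $X\subseteq H(\mathbb{D})$, $S[X]=\{g\in H(\mathbb{D}): S_g \text{ is bounded on } X\}$. $H^\infty$ is the space of bounded analytic functions on $\mathbb{D}$ with the supremum norm.
   Formalization: The formal statement additionally assumes that X contains a nonconstant function; without this the claim is false, since for X = {0} or X = the constants every S_g is zero and S[X] is all of H(D). *)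

theory Defs
  imports "HOL-Complex_Analysis.Complex_Analysis"
begin

abbreviation unit_disc :: "complex set" where
  "unit_disc \<equiv> ball 0 1"

text \<open>Elements of \<open>H(\<D>)\<close> are represented by their extension by zero to \<open>\<complex>\<close>, so that
  equality of HOL functions is equality on the disc.\<close>

definition analytic_disc :: "(complex \<Rightarrow> complex) set" where
  "analytic_disc = {f. f holomorphic_on unit_disc \<and> (\<forall>z. z \<notin> unit_disc \<longrightarrow> f z = 0)}"

definition Hinf :: "(complex \<Rightarrow> complex) set" where
  "Hinf = {f \<in> analytic_disc. bounded (f ` unit_disc)}"

definition S_op :: "(complex \<Rightarrow> complex) \<Rightarrow> (complex \<Rightarrow> complex) \<Rightarrow> complex \<Rightarrow> complex" where
  "S_op g f z = (if z \<in> unit_disc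
     then contour_integral (linepath 0 z) (\<lambda>t. deriv f t * g t) else 0)"

text \<open>The norm \<open>N\<close> is only meaningful on \<open>X\<close>; its values elsewhere are irrelevant.\<close>

definition banach_space_on_disc ::
  "(complex \<Rightarrow> complex) set \<Rightarrow> ((complex \<Rightarrow> complex) \<Rightarrow> real) \<Rightarrow> bool" where
  "banach_space_on_disc X N \<longleftrightarrow>
     X \<subseteq> analytic_disc \<and>
     (\<lambda>z. 0) \<in> X \<and>
     (\<forall>f\<in>X. \<forall>h\<in>X. (\<lambda>z. f z + h z) \<in> X) \<and>
     (\<forall>c. \<forall>f\<in>X. (\<lambda>z. c * f z) \<in> X) \<and>
     (\<forall>f\<in>X. 0 \<le> N f) \<and>
     (\<forall>f\<in>X. N f = 0 \<longleftrightarrow> f = (\<lambda>z. 0)) \<and>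
     (\<forall>c. \<forall>f\<in>X. N (\<lambda>z. c * f z) = cmod c * N f) \<and>
     (\<forall>f\<in>X. \<forall>h\<in>X. N (\<lambda>z. f z + h z) \<le> N f + N h) \<and>
     (\<forall>s. (\<forall>n::nat. s n \<in> X) \<and>
          (\<forall>e>0. \<exists>M. \<forall>m\<ge>M. \<forall>n\<ge>M. N (\<lambda>z. s m z - s n z) < e) \<longrightarrow>
          (\<exists>f\<in>X. (\<lambda>n. N (\<lambda>z. s n z - f z)) \<longlonglongrightarrow> 0))"

definition bounded_functional_on ::
  "(complex \<Rightarrow> complex) set \<Rightarrow> ((complex \<Rightarrow> complex) \<Rightarrow> real) \<Rightarrow>
   ((complex \<Rightarrow> complex) \<Rightarrow> complex) \<Rightarrow> bool" where
  "bounded_functional_on X N \<phi> \<longleftrightarrow>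
     (\<forall>f\<in>X. \<forall>h\<in>X. \<phi> (\<lambda>z. f z + h z) = \<phi> f + \<phi> h) \<and>
     (\<forall>c. \<forall>f\<in>X. \<phi> (\<lambda>z. c * f z) = c * \<phi> f) \<and>
     (\<exists>C. \<forall>f\<in>X. cmod (\<phi> f) \<le> C * N f)"

definition bounded_operator_on ::
  "(complex \<Rightarrow> complex) set \<Rightarrow> ((complex \<Rightarrow> complex) \<Rightarrow> real) \<Rightarrow>
   ((complex \<Rightarrow> complex) \<Rightarrow> (complex \<Rightarrow> complex)) \<Rightarrow> bool" where
  "bounded_operator_on X N T \<longleftrightarrow>
     T ` X \<subseteq> X \<and>
     (\<forall>f\<in>X. \<forall>h\<in>X. T (\<lambda>z. f z + h z) = (\<lambda>z. T f z + T h z)) \<and>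
     (\<forall>c. \<forall>f\<in>X. T (\<lambda>z. c * f z) = (\<lambda>z. c * T f z)) \<and>
     (\<exists>C. \<forall>f\<in>X. N (T f) \<le> C * N f)"

definition S_symbols ::
  "(complex \<Rightarrow> complex) set \<Rightarrow> ((complex \<Rightarrow> complex) \<Rightarrow> real) \<Rightarrow> (complex \<Rightarrow> complex) set" where
  "S_symbols X N = {g \<in> analytic_disc. bounded_operator_on X N (S_op g)}"

text \<open>If \<open>X\<close> consists of constants only, then every \<open>S_op g\<close> vanishes on \<open>X\<close> and
  \<open>S_symbols X N\<close> is all of \<open>analytic_disc\<close>. A theorem bounding the symbols therefore has to
  assume that \<open>X\<close> contains a nonconstant function.\<close>

end

theory Submission imports Defs begin

text \<open>
  Differentiating the defining integral gives \<open>(S\<^sub>g f)'(z) = f'(z) g(z)\<close>. In other words, the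
  functional \<open>f \<mapsto> f'(z)\<close> is an eigenvector of the adjoint of \<open>S\<^sub>g\<close> with eigenvalue \<open>g(z)\<close>,
  as long as it does not vanish identically on \<open>X\<close>. An eigenvalue of the adjoint never exceeds
  the operator norm in modulus (lemma \<open>cmod_eigenvalue_le\<close>), so \<open>\<bar>g(z)\<bar>\<close> is bounded by the
  norm of \<open>S\<^sub>g\<close> at every such point.

  The exceptional points \<open>z\<close>, at which all members of \<open>X\<close> have a critical point, are handled by
  continuity of \<open>g\<close>: if \<open>\<bar>g\<bar>\<close> were larger than the norm of \<open>S\<^sub>g\<close> somewhere, it would be so on a
  nonempty open set. The derivative of every member of \<open>X\<close> would vanish on this set, hence on
  the whole disc by the identity theorem, and \<open>X\<close> would contain only constants.
\<close>

text \<open>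
  Iterating \<open>T\<close> gives \<open>\<bar>c\<bar>\<^sup>n \<bar>\<phi> x\<bar> = \<bar>\<phi> (T\<^sup>n x)\<bar> \<le> K C\<^sup>n N x\<close> for all \<open>n\<close>, which forces
  \<open>\<bar>c\<bar> \<le> C\<close> whatever the size of \<open>K\<close>. Working with powers at a single vector \<open>x\<close> avoids a
  supremum defining the norm of \<open>\<phi>\<close>.
\<close>

lemma cmod_eigenvalue_le:
  fixes N :: "'a \<Rightarrow> real" and \<phi> :: "'a \<Rightarrow> complex"
  assumes T: "\<And>f. f \<in> X \<Longrightarrow> T f \<in> X"
    and N_nonneg: "\<And>f. f \<in> X \<Longrightarrow> 0 \<le> N f"
    and T_bound: "\<And>f. f \<in> X \<Longrightarrow> N (T f) \<le> C * N f"
    and \<phi>_bound: "\<And>f. f \<in> X \<Longrightarrow> cmod (\<phi> f) \<le> K * N f"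
    and eigen: "\<And>f. f \<in> X \<Longrightarrow> \<phi> (T f) = c * \<phi> f"
    and x: "x \<in> X" "\<phi> x \<noteq> 0" and C: "0 \<le> C"
  shows "cmod c \<le> C"
proof (rule ccontr)
  assume "\<not> cmod c \<le> C"
  then have less: "C < cmod c" by simp
  have "0 < K * N x"
    using \<phi>_bound[OF x(1)] x(2) by (meson less_le_trans zero_less_norm_iff)
  then have K: "0 \<le> K"
    using N_nonneg[OF x(1)] by (simp add: zero_less_mult_iff)
  have iterate: "(T ^^ n) x \<in> X \<and> N ((T ^^ n) x) \<le> C ^ n * N x \<and> \<phi> ((T ^^ n) x) = c ^ n * \<phi> x"
    for n
  proof (induction n)
    case 0
    show ?case using x by simp
  next
    case (Suc n)
    have "N (T ((T ^^ n) x)) \<le> C * N ((T ^^ n) x)"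
      using Suc T_bound by blast
    also have "\<dots> \<le> C * (C ^ n * N x)"
      using Suc C by (intro mult_left_mono) auto
    finally show ?case using Suc T eigen by (simp add: mult.assoc)
  qed
  have "cmod (\<phi> x) \<le> K * N x * (C / cmod c) ^ n" for n
  proof -
    have "cmod c ^ n * cmod (\<phi> x) \<le> K * N ((T ^^ n) x)"
      using iterate[of n] \<phi>_bound[of "(T ^^ n) x"] by (simp add: norm_mult norm_power)
    also have "\<dots> \<le> K * (C ^ n * N x)"
      using iterate[of n] K by (intro mult_left_mono) auto
    finally have "cmod (\<phi> x) * cmod c ^ n \<le> K * N x * C ^ n"
      by (simp add: mult_ac)
    moreover have "0 < cmod c ^ n"
      using less C by (intro zero_less_power) linarith
    ultimately show ?thesis
      by (simp add: power_divide pos_le_divide_eq)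
  qed
  moreover have "(\<lambda>n. K * N x * (C / cmod c) ^ n) \<longlonglongrightarrow> K * N x * 0"
  proof -
    have "0 < cmod c" using less C by linarith
    with less have "C / cmod c < 1" by (simp only: divide_less_eq_1_pos)
    with C have "(\<lambda>n. (C / cmod c) ^ n) \<longlonglongrightarrow> 0"
      by (intro LIMSEQ_realpow_zero) simp_all
    then show ?thesis by (rule tendsto_mult_left)
  qed
  ultimately have "cmod (\<phi> x) \<le> K * N x * 0"
    by (intro LIMSEQ_le_const) auto
  with x show False by simp
qed

text \<open>
  The disc is convex, so \<open>f' g\<close> has a holomorphic primitive there and the radial integral
  equals this primitive up to a constant.
\<close>

lemma deriv_S_op:
  assumes f: "f holomorphic_on unit_disc" and g: "g holomorphic_on unit_disc"
    and z: "z \<in> unit_disc"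
  shows "deriv (S_op g f) z = deriv f z * g z"
proof -
  have "(\<lambda>t. deriv f t * g t) holomorphic_on unit_disc"
    using f g by (intro holomorphic_intros) auto
  then obtain F where F: "\<And>w. w \<in> unit_disc \<Longrightarrow>
      (F has_field_derivative deriv f w * g w) (at w within unit_disc)"
    using holomorphic_convex_primitive'[of unit_disc "\<lambda>t. deriv f t * g t"]
    by (auto simp: convex_ball)
  have S_eq: "S_op g f w = F w - F 0" if w: "w \<in> unit_disc" for w
  proof -
    have "path_image (linepath 0 w) \<subseteq> unit_disc"
      using w by (simp add: closed_segment_subset)
    then have "((\<lambda>t. deriv f t * g t) has_contour_integral
        F (pathfinish (linepath 0 w)) - F (pathstart (linepath 0 w))) (linepath 0 w)"
      using F by (intro contour_integral_primitive[of unit_disc]) blast+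
    then show ?thesis
      using w by (simp add: S_op_def contour_integral_unique)
  qed
  have "(F has_field_derivative deriv f z * g z) (at z)"
    using F[OF z] at_within_open[OF z open_ball] by simp
  then have "((\<lambda>w. F w - F 0) has_field_derivative deriv f z * g z) (at z)"
    by (auto intro!: derivative_eq_intros)
  then have "(S_op g f has_field_derivative deriv f z * g z) (at z)"
    by (rule has_field_derivative_transform_within_open[where S = unit_disc])
      (use z S_eq in auto)
  then show ?thesis by (rule DERIV_imp_deriv)
qed

lemma constant_on_if_deriv_zero_on_open:
  assumes f: "f holomorphic_on S" and S: "open S" "connected S"
    and U: "open U" "U \<noteq> {}" "U \<subseteq> S" and zero: "\<And>z. z \<in> U \<Longrightarrow> deriv f z = 0"
  shows "f constant_on S"
proof -
  have "deriv f z = 0" if "z \<in> S" for z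
    by (rule analytic_continuation_open[of U S "deriv f" "\<lambda>_. 0"])
      (use f S U zero that in \<open>auto intro!: holomorphic_deriv\<close>)
  moreover have "(f has_field_derivative deriv f z) (at z)" if "z \<in> S" for z
    using f S(1) that by (rule holomorphic_derivI)
  ultimately have "\<And>z. z \<in> S \<Longrightarrow> (f has_field_derivative 0) (at z)"
    by metis
  then obtain c where "\<And>z. z \<in> S \<Longrightarrow> f z = c"
    using DERIV_zero_connected_constant[of S "{}" f] S f holomorphic_on_imp_continuous_on
    by (metis Diff_empty finite.emptyI)
  then show ?thesis by (auto simp: constant_on_def)
qed

theorem proposition2p2:
  fixes X :: "(complex \<Rightarrow> complex) set" and N :: "(complex \<Rightarrow> complex) \<Rightarrow> real"
  assumes "banach_space_on_disc X N"
    and "\<exists>f\<in>X. \<not> f constant_on unit_disc"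
    and "\<And>z. z \<in> unit_disc \<Longrightarrow> bounded_functional_on X N (\<lambda>f. deriv f z)"
  shows "S_symbols X N \<subseteq> Hinf"
proof
  fix g assume "g \<in> S_symbols X N"
  then have g: "g \<in> analytic_disc" and op: "bounded_operator_on X N (S_op g)"
    by (auto simp: S_symbols_def)
  have g_hol: "g holomorphic_on unit_disc"
    using g by (simp add: analytic_disc_def)
  have X_hol: "f holomorphic_on unit_disc" and N_nonneg: "0 \<le> N f" if "f \<in> X" for f
    using assms(1) that by (auto simp: banach_space_on_disc_def analytic_disc_def)
  obtain C0 where C0: "\<And>f. f \<in> X \<Longrightarrow> N (S_op g f) \<le> C0 * N f"
    using op unfolding bounded_operator_on_def by blast
  define C where "C = max C0 0"
  have C: "0 \<le> C" by (simp add: C_def)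
  have C_bound: "N (S_op g h) \<le> C * N h" if "h \<in> X" for h
  proof -
    have "C0 * N h \<le> C * N h"
      using N_nonneg[OF that] by (intro mult_right_mono) (simp_all add: C_def)
    with C0[OF that] show ?thesis by simp
  qed
  obtain f where f: "f \<in> X" "\<not> f constant_on unit_disc"
    using assms(2) by blast
  have noncritical: "cmod (g z) \<le> C" if z: "z \<in> unit_disc" and "deriv f z \<noteq> 0" for z
  proof -
    obtain K where "\<And>h. h \<in> X \<Longrightarrow> cmod (deriv h z) \<le> K * N h"
      using assms(3)[OF z] unfolding bounded_functional_on_def by blast
    moreover have "S_op g h \<in> X" if "h \<in> X" for h
      using op that by (auto simp: bounded_operator_on_def)
    moreover have "deriv (S_op g h) z = g z * deriv h z" if "h \<in> X" for h
      using deriv_S_op[OF X_hol[OF that] g_hol z] by (simp add: mult.commute)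
    ultimately show ?thesis
      using cmod_eigenvalue_le[where \<phi> = "\<lambda>h. deriv h z" and T = "S_op g" and x = f]
        N_nonneg C_bound f(1) \<open>deriv f z \<noteq> 0\<close> C
      by blast
  qed
  define U where "U = {z \<in> unit_disc. C < cmod (g z)}"
  have "open U"
  proof -
    have "continuous_on unit_disc (\<lambda>z. cmod (g z))"
      using g_hol by (intro continuous_on_norm holomorphic_on_imp_continuous_on)
    then have "open (unit_disc \<inter> (\<lambda>z. cmod (g z)) -` {C<..})"
      by (intro continuous_open_preimage) auto
    moreover have "U = unit_disc \<inter> (\<lambda>z. cmod (g z)) -` {C<..}"
      by (auto simp: U_def)
    ultimately show ?thesis by simp
  qed
  have "U = {}"
  proof (rule ccontr)
    assume "U \<noteq> {}"
    moreover have "U \<subseteq> unit_disc" by (auto simp: U_def)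
    moreover have "deriv f z = 0" if "z \<in> U" for z
      using noncritical[of z] that by (force simp: U_def)
    ultimately have "f constant_on unit_disc"
      using constant_on_if_deriv_zero_on_open[OF X_hol[OF f(1)] open_ball connected_ball \<open>open U\<close>]
      by blast
    with f(2) show False by simp
  qed
  then have "\<And>z. z \<in> unit_disc \<Longrightarrow> cmod (g z) \<le> C"
    unfolding U_def by (metis (mono_tags, lifting) empty_Collect_eq not_le)
  then have "bounded (g ` unit_disc)"
    by (intro boundedI[where B = C]) blast
  with g show "g \<in> Hinf" by (simp add: Hinf_def)
qed

end
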